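(* Let $T_0<\dots<T_{r-1}$ be positive integers with $T_k=b_kT_{k-1}$ for integers $b_k\ge 2$; put $w=T_0$, $\mathbf b=(b_1,\dots,b_{r-1})$, $B_k=\prod_{m=1}^kb_m$ ($B_0=1$), $H=B_{r-1}$. Let $I$ be an instance with jobs $J_1,\dots,J_n$, job $J_i$ having positive integer processing time $p_i$ and period $T_{\pi_i}$, $\pi_i\in\{0,\dots,r-1\}$. Let $\phi(I)$ be the height-divisible 2D packing instance with a bin of width $w$ and height $H$ and rectangles $R_1,\dots,R_n$, where $R_i$ has width $\ell_i=p_i$ and height $h_i=T_{r-1}/T_{\pi_i}=H/B_{\pi_i}$. (i) If $(u_i,v_i)_{i}$ is a feasible (collision-free) periodic schedule of $I$, then setting $x_i=u_i$ and $y_i=h_i\cdot\mathrm{flip}(v_i,\pi_i,\mathbf b)$ for all $i$ gives a feasible height-divisible packing of $\phi(I)$. (ii) Conversely, if $(x_i,y_i)_i$ is a feasible height-divisible packing of $\phi(I)$, then setting $u_i=x_i$ and $v_i=\mathrm{flip}(y_i/h_i,\pi_i,\mathrm{bflip}(\mathbf b,\pi_i))$ for all $i$ gives a feasible periodic schedule of $I$.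
   Context: Periodic schedules: a schedule assigns to each job $J_i$ integers $u_i,v_i$ with $0\le u_i$, $u_i+p_i\le w$, $0\le v_i<B_{\pi_i}$; the start offset is $s_i=u_i+v_iw$, and the occurrences of $J_i$ are the intervals $[s_i+kT_{\pi_i},s_i+kT_{\pi_i}+p_i)$, $k\ge 0$ integer. The schedule is feasible if no occurrences of two distinct jobs intersect. Packings: a packing of $\phi(I)$ assigns to each rectangle $R_i$ integer bottom-left coordinates $(x_i,y_i)$; it is feasible if $x_i\ge 0$, $y_i\ge0$, $x_i+\ell_i\le w$, $y_i+h_i\le H$ for all $i$, and no two distinct rectangles overlap (overlap of $R_i,R_j$ meaning $x_i-\ell_j<x_j<x_i+\ell_i$ and $y_i-h_j<y_j<y_i+h_i$); it is height-divisible if $y_i$ is divisible by $h_i$ for all $i$. Mixed radix and flip: every integer $0\le y<H$ is uniquely $y=\sum_{m=1}^{r-1}y_mB_{m-1}$ with $0\le y_m<b_m$. For $0\le k\le r-1$, $\mathrm{bflip}(\mathbf b,k)=(b_k,\dots,b_1,b_{k+1},\dots,b_{r-1})$, and $\mathrm{flip}(y,k,\mathbf b)=y_k+y_{k-1}b_k+y_{k-2}b_kb_{k-1}+\dots+y_1(b_2\cdots b_k)+\sum_{m=k+1}^{r-1}y_mB_{m-1}$, i.e. the number whose digits with respect to $\mathrm{bflip}(\mathbf b,k)$ are $y_k,\dots,y_1,y_{k+1},\dots,y_{r-1}$ (least significant first); for another base vector $\mathbf c$ of the same product, $\mathrm{flip}(\cdot,k,\mathbf c)$ is defined identically using digits with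 respect to $\mathbf c$ (for $k=0$, flip is the identity). *)

theory Defs
  imports Complex_Main
begin

text \<open>A base vector $(b_1,\dots,b_{r-1})$ is a function on the indices \<open>1..r-1\<close>; its values
  elsewhere are irrelevant. \<open>radix_prod b k\<close> is $B_k$.\<close>

definition radix_prod :: "(nat \<Rightarrow> int) \<Rightarrow> nat \<Rightarrow> int" where
  "radix_prod b k = (\<Prod>m=1..k. b m)"

text \<open>The digit $y_m$ of \<open>y\<close> in mixed radix \<open>b\<close>, for \<open>m \<ge> 1\<close>, least significant first. Existence
  and uniqueness of the expansion are \<open>digit_expansion\<close> and \<open>digit_unique\<close> below.\<close>

definition digit :: "(nat \<Rightarrow> int) \<Rightarrow> nat \<Rightarrow> int \<Rightarrow> int" where
  "digit b m y = (y div radix_prod b (m - 1)) mod b m"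

definition bflip :: "(nat \<Rightarrow> int) \<Rightarrow> nat \<Rightarrow> nat \<Rightarrow> int" where
  "bflip b k = (\<lambda>m. if 1 \<le> m \<and> m \<le> k then b (k + 1 - m) else b m)"

text \<open>The parameter \<open>r\<close> says that the base vector has \<open>r - 1\<close> entries.\<close>

definition flip :: "nat \<Rightarrow> int \<Rightarrow> nat \<Rightarrow> (nat \<Rightarrow> int) \<Rightarrow> int" where
  "flip r y k b = (\<Sum>m=1..k. digit b m y * (\<Prod>j=m+1..k. b j))
                + (\<Sum>m=k+1..r-1. digit b m y * radix_prod b (m - 1))"

definition occurrence :: "int \<Rightarrow> int \<Rightarrow> int \<Rightarrow> nat \<Rightarrow> real set" where
  "occurrence period len s k =
     {real_of_int (s + int k * period) ..< real_of_int (s + int k * period + len)}"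

text \<open>Jobs are numbered \<open>1..n\<close>; job \<open>i\<close> has processing time \<open>p i\<close> and period \<open>T (\<pi> i)\<close>.
  The bin width $w$ is \<open>T 0\<close>.\<close>

definition start_offset :: "(nat \<Rightarrow> int) \<Rightarrow> (nat \<Rightarrow> int) \<Rightarrow> (nat \<Rightarrow> int) \<Rightarrow> nat \<Rightarrow> int" where
  "start_offset T u v i = u i + v i * T 0"

definition feasible_schedule ::
  "(nat \<Rightarrow> int) \<Rightarrow> (nat \<Rightarrow> int) \<Rightarrow> nat \<Rightarrow> (nat \<Rightarrow> int) \<Rightarrow> (nat \<Rightarrow> nat) \<Rightarrow> (nat \<Rightarrow> int) \<Rightarrow> (nat \<Rightarrow> int) \<Rightarrow> bool" where
  "feasible_schedule T b n p \<pi> u v \<longleftrightarrow>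
     (\<forall>i\<in>{1..n}. 0 \<le> u i \<and> u i + p i \<le> T 0 \<and> 0 \<le> v i \<and> v i < radix_prod b (\<pi> i)) \<and>
     (\<forall>i\<in>{1..n}. \<forall>j\<in>{1..n}. i \<noteq> j \<longrightarrow>
        (\<forall>k l. occurrence (T (\<pi> i)) (p i) (start_offset T u v i) k \<inter>
               occurrence (T (\<pi> j)) (p j) (start_offset T u v j) l = {}))"

record packing_instance =
  bin_width :: int
  bin_height :: int
  num_rects :: nat
  rect_width :: "nat \<Rightarrow> int"
  rect_height :: "nat \<Rightarrow> int"

definition overlap :: "packing_instance \<Rightarrow> (nat \<Rightarrow> int) \<Rightarrow> (nat \<Rightarrow> int) \<Rightarrow> nat \<Rightarrow> nat \<Rightarrow> bool" where
  "overlap P x y i j \<longleftrightarrow>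
     x i - rect_width P j < x j \<and> x j < x i + rect_width P i \<and>
     y i - rect_height P j < y j \<and> y j < y i + rect_height P i"

definition feasible_packing :: "packing_instance \<Rightarrow> (nat \<Rightarrow> int) \<Rightarrow> (nat \<Rightarrow> int) \<Rightarrow> bool" where
  "feasible_packing P x y \<longleftrightarrow>
     (\<forall>i\<in>{1..num_rects P}. 0 \<le> x i \<and> 0 \<le> y i \<and>
        x i + rect_width P i \<le> bin_width P \<and> y i + rect_height P i \<le> bin_height P) \<and>
     (\<forall>i\<in>{1..num_rects P}. \<forall>j\<in>{1..num_rects P}. i \<noteq> j \<longrightarrow> \<not> overlap P x y i j)"

definition height_divisible :: "packing_instance \<Rightarrow> (nat \<Rightarrow> int) \<Rightarrow> bool" where
  "height_divisible P y \<longleftrightarrow> (\<forall>i\<in>{1..num_rects P}. rect_height P i dvd y i)"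

text \<open>The division in the heights is exact and equals $H/B_{\pi_i}$: see
  \<open>height_eq\<close> and \<open>height_exact\<close> below.\<close>

definition to_packing ::
  "nat \<Rightarrow> (nat \<Rightarrow> int) \<Rightarrow> (nat \<Rightarrow> int) \<Rightarrow> nat \<Rightarrow> (nat \<Rightarrow> int) \<Rightarrow> (nat \<Rightarrow> nat) \<Rightarrow> packing_instance" where
  "to_packing r T b n p \<pi> =
     \<lparr>bin_width = T 0, bin_height = radix_prod b (r - 1), num_rects = n,
      rect_width = p, rect_height = (\<lambda>i. T (r - 1) div T (\<pi> i))\<rparr>"

lemma radix_prod_Suc: "radix_prod b (Suc k) = radix_prod b k * b (Suc k)"
  by (simp add: radix_prod_def)

lemma radix_prod_pos: "(\<And>m. 1 \<le> m \<Longrightarrow> m \<le> k \<Longrightarrow> 0 < b m) \<Longrightarrow> 0 < radix_prod b k"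
  unfolding radix_prod_def by (rule prod_pos) simp

lemma mod_radix_prod:
  assumes "\<And>m. 1 \<le> m \<Longrightarrow> m \<le> k \<Longrightarrow> 0 < b m"
  shows "y mod radix_prod b k = (\<Sum>m=1..k. digit b m y * radix_prod b (m - 1))"
  using assms
proof (induction k)
  case 0
  then show ?case by (simp add: radix_prod_def)
next
  case (Suc k)
  have "0 < radix_prod b k" "0 < b (Suc k)"
    using Suc.prems by (auto intro: radix_prod_pos)
  then have "y mod radix_prod b (Suc k)
      = radix_prod b k * (y div radix_prod b k mod b (Suc k)) + y mod radix_prod b k"
    by (simp add: radix_prod_Suc zmod_zmult2_eq)
  then show ?case
    using Suc by (simp add: digit_def mult.commute)
qed

lemma digit_expansion:
  assumes "\<And>m. 1 \<le> m \<Longrightarrow> m \<le> k \<Longrightarrow> 0 < b m" and "0 \<le> y" "y < radix_prod b k"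
  shows "y = (\<Sum>m=1..k. digit b m y * radix_prod b (m - 1))"
  using mod_radix_prod[of k b y] assms by simp

lemma digit_expansion_less:
  assumes "\<And>m. 1 \<le> m \<Longrightarrow> m \<le> k \<Longrightarrow> 0 \<le> d m \<and> d m < b m"
  shows "0 \<le> (\<Sum>m=1..k. d m * radix_prod b (m - 1)) \<and>
         (\<Sum>m=1..k. d m * radix_prod b (m - 1)) < radix_prod b k"
  using assms
proof (induction k)
  case 0
  then show ?case by (simp add: radix_prod_def)
next
  case (Suc k)
  let ?S = "\<Sum>m=1..k. d m * radix_prod b (m - 1)"
  have IH: "0 \<le> ?S" "?S < radix_prod b k" using Suc by auto
  have d: "0 \<le> d (Suc k)" "d (Suc k) \<le> b (Suc k) - 1" using Suc.prems[of "Suc k"] by auto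
  have "0 \<le> d (Suc k) * radix_prod b k" using d IH by simp
  moreover have "d (Suc k) * radix_prod b k \<le> (b (Suc k) - 1) * radix_prod b k"
    using d IH by (intro mult_right_mono) auto
  ultimately show ?case using IH by (simp add: radix_prod_Suc algebra_simps)
qed

lemma digit_unique:
  assumes "\<And>m. 1 \<le> m \<Longrightarrow> m \<le> k \<Longrightarrow> 0 \<le> d m \<and> d m < b m"
    and "y = (\<Sum>m=1..k. d m * radix_prod b (m - 1))"
    and "1 \<le> m" "m \<le> k"
  shows "d m = digit b m y"
  using assms
proof (induction k arbitrary: y)
  case 0
  then show ?case by simp
next
  case (Suc k)
  let ?S = "\<Sum>m=1..k. d m * radix_prod b (m - 1)"
  have S: "0 \<le> ?S" "?S < radix_prod b k"
    using digit_expansion_less[of k d b] Suc.prems(1) by auto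
  have y: "y = ?S + d (Suc k) * radix_prod b k" using Suc.prems(2) by simp
  show ?case
  proof (cases "m = Suc k")
    case True
    then show ?thesis
      using S y Suc.prems(1)[of "Suc k"] by (simp add: digit_def)
  next
    case False
    then have m: "m \<le> k" using Suc.prems by simp
    have pos: "0 < b j" if "1 \<le> j" "j \<le> k" for j using Suc.prems(1)[of j] that by simp
    have split: "{1..k} = {1..m} \<union> {m+1..k}" using m by auto
    have "radix_prod b k = radix_prod b m * (\<Prod>j=m+1..k. b j)"
      unfolding radix_prod_def split by (rule prod.union_disjoint) auto
    then obtain c where c: "radix_prod b k = radix_prod b (m - 1) * (b m * c)"
      using Suc.prems(3) radix_prod_Suc[of b "m - 1"] by (auto simp: mult.assoc)
    have P: "0 < radix_prod b (m - 1)" using pos m by (auto intro: radix_prod_pos)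
    have "y = ?S + (b m * (c * d (Suc k))) * radix_prod b (m - 1)"
      using y c by (simp add: mult.assoc mult.left_commute mult.commute)
    then have "y div radix_prod b (m - 1) = b m * (c * d (Suc k)) + ?S div radix_prod b (m - 1)"
      using P by simp
    then have "digit b m y = digit b m ?S" by (simp add: digit_def)
    then show ?thesis using Suc.IH[of ?S] Suc.prems m by simp
  qed
qed

lemma period_eq:
  assumes "\<forall>k\<in>{1..<r}. T k = b k * T (k - 1)" "k < r"
  shows "T k = radix_prod b k * T 0"
  using assms(2)
proof (induction k)
  case 0
  then show ?case by (simp add: radix_prod_def)
next
  case (Suc k)
  then show ?case using assms(1) by (simp add: radix_prod_Suc)
qed

lemma height_exact:
  assumes "\<forall>k\<in>{1..<r}. T k = b k * T (k - 1)" "k < r"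
  shows "T k dvd T (r - 1)" and "radix_prod b k dvd radix_prod b (r - 1)"
proof -
  show *: "radix_prod b k dvd radix_prod b (r - 1)"
    unfolding radix_prod_def using assms(2) by (intro prod_dvd_prod_subset) auto
  then show "T k dvd T (r - 1)"
    using period_eq[OF assms] period_eq[OF assms(1), of "r - 1"] assms(2) by auto
qed

lemma height_eq:
  assumes "\<forall>k\<in>{1..<r}. T k = b k * T (k - 1)" "k < r" "0 < T 0"
  shows "T (r - 1) div T k = radix_prod b (r - 1) div radix_prod b k"
  using period_eq[OF assms(1,2)] period_eq[OF assms(1), of "r - 1"] assms(2,3) by simp

end

theory Submission
  imports Defs
begin

text \<open>Cut the time axis into slots of length $w$. Every occurrence lies inside one slot, so jobs
  \<open>i\<close> and \<open>j\<close> with $\pi_i \le \pi_j$ collide iff the intervals given by $u_i$ and $u_j$ meet and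
  some slot is congruent to $v_i$ modulo $B_{\pi_i}$ and to $v_j$ modulo $B_{\pi_j}$, i.e. iff
  $v_j \equiv v_i$ modulo $B_{\pi_i}$: the lowest $\pi_i$ digits agree. Digit reversal moves these
  digits to the top of $v_j$, where agreement says that the integer part of the reversed $v_j$
  divided by $h_i / h_j$ is the reversed $v_i$, which is vertical overlap of the rectangles.\<close>

section \<open>Digit reversal in mixed radix\<close>

definition digit_rev :: "(nat \<Rightarrow> int) \<Rightarrow> nat \<Rightarrow> int \<Rightarrow> int" where
  "digit_rev b k y = (\<Sum>m=1..k. digit b m y * (\<Prod>j=m+1..k. b j))"

lemma digit_rev_0 [simp]: "digit_rev b 0 y = 0"
  by (simp add: digit_rev_def)

text \<open>A Horner step: the highest digit read from \<open>y\<close> becomes the bottom digit of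
  the reversal. The inductions below rest on this recursion.\<close>

lemma digit_rev_Suc:
  "digit_rev b (Suc k) y = b (Suc k) * digit_rev b k y + digit b (Suc k) y"
proof -
  have "(\<Sum>m=1..k. digit b m y * (\<Prod>j=m+1..Suc k. b j)) = b (Suc k) * digit_rev b k y"
    by (auto simp: digit_rev_def sum_distrib_left intro!: sum.cong)
  then show ?thesis by (simp add: digit_rev_def)
qed

lemma radix_prod_split:
  "k \<le> l \<Longrightarrow> radix_prod b l = radix_prod b k * (\<Prod>j=k+1..l. b j)"
  using prod.ub_add_nat[of 1 k b "l - k"] by (simp add: radix_prod_def)

lemma digit_bounds: "0 < b m \<Longrightarrow> 0 \<le> digit b m y \<and> digit b m y < b m"
  by (simp add: digit_def)

lemma digit_rev_bounds:
  assumes "\<And>m. 1 \<le> m \<Longrightarrow> m \<le> k \<Longrightarrow> 0 < b m"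
  shows "0 \<le> digit_rev b k y \<and> digit_rev b k y < radix_prod b k"
  using assms
proof (induction k)
  case 0
  then show ?case by (simp add: radix_prod_def)
next
  case (Suc k)
  then have IH: "0 \<le> digit_rev b k y" "digit_rev b k y + 1 \<le> radix_prod b k"
    and d: "0 \<le> digit b (Suc k) y" "digit b (Suc k) y < b (Suc k)"
    using digit_bounds[of b "Suc k" y] by force+
  have "b (Suc k) * (digit_rev b k y + 1) \<le> b (Suc k) * radix_prod b k"
    using IH d by (intro mult_left_mono) auto
  then show ?case
    using IH d by (simp add: digit_rev_Suc radix_prod_Suc algebra_simps)
qed

text \<open>In the reversal, digits \<open>k + 1\<close> to \<open>l\<close> of \<open>y\<close>
  fill the lowest places, and the division cuts them off, one Horner step at a time.\<close>

lemma digit_rev_div: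
  assumes "\<And>m. 1 \<le> m \<Longrightarrow> m \<le> l \<Longrightarrow> 0 < b m" and "k \<le> l"
  shows "digit_rev b l y div (\<Prod>j=k+1..l. b j) = digit_rev b k y"
  using assms(2,1)
proof (induction l rule: dec_induct)
  case base
  then show ?case by simp
next
  case (step l)
  have b: "0 < b (Suc l)" using step.prems[of "Suc l"] by simp
  have "digit_rev b (Suc l) y div b (Suc l) = digit_rev b l y"
    using digit_bounds[of b "Suc l" y] b by (simp add: digit_rev_Suc)
  moreover have "(\<Prod>j=k+1..Suc l. b j) = b (Suc l) * (\<Prod>j=k+1..l. b j)"
    using step.hyps by simp
  moreover have "0 \<le> (\<Prod>j=k+1..l. b j)"
    using step.prems by (intro prod_nonneg) (simp add: less_imp_le)
  ultimately have "digit_rev b (Suc l) y div (\<Prod>j=k+1..Suc l. b j) =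
      digit_rev b l y div (\<Prod>j=k+1..l. b j)"
    by (simp only: zdiv_zmult2_eq)
  then show ?case using step by simp
qed

text \<open>Each side says that the first \<open>k\<close> digits agree. The induction splits off
  digit \<open>Suc k\<close>, which is the bottom digit of the reversal and the top digit of the
  residue.\<close>

lemma digit_rev_eq_iff:
  assumes "\<And>m. 1 \<le> m \<Longrightarrow> m \<le> k \<Longrightarrow> 0 < b m"
  shows "digit_rev b k y = digit_rev b k z \<longleftrightarrow> y mod radix_prod b k = z mod radix_prod b k"
  using assms
proof (induction k)
  case 0
  then show ?case by (simp add: radix_prod_def)
next
  case (Suc k)
  have pos: "0 < radix_prod b k" "0 < b (Suc k)"
    using Suc.prems by (auto intro: radix_prod_pos)
  \<comment> \<open>Uniqueness of quotient and remainder, applied with divisor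
    \<open>b (Suc k)\<close> to the reversals and with \<open>radix_prod b k\<close> to the
    residues.\<close>
  have eq_iff: "c * q + s = c * q' + s' \<longleftrightarrow> q = q' \<and> s = s'"
    if "0 \<le> s" "s < c" "0 \<le> s'" "s' < c" for c q s q' s' :: int
  proof
    assume *: "c * q + s = c * q' + s'"
    have "q = (c * q + s) div c" "q' = (c * q' + s') div c" using that by simp_all
    with * show "q = q' \<and> s = s'" by simp
  qed simp
  have "digit_rev b (Suc k) y = digit_rev b (Suc k) z \<longleftrightarrow>
      digit_rev b k y = digit_rev b k z \<and> digit b (Suc k) y = digit b (Suc k) z"
    unfolding digit_rev_Suc using pos digit_bounds by (intro eq_iff) auto
  also have "\<dots> \<longleftrightarrow> y mod radix_prod b k = z mod radix_prod b k \<and>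
      digit b (Suc k) y = digit b (Suc k) z"
    using Suc by simp
  also have "\<dots> \<longleftrightarrow> radix_prod b k * digit b (Suc k) y + y mod radix_prod b k =
      radix_prod b k * digit b (Suc k) z + z mod radix_prod b k"
    using pos by (subst eq_iff) auto
  also have "\<dots> \<longleftrightarrow> y mod radix_prod b (Suc k) = z mod radix_prod b (Suc k)"
    using pos by (simp add: radix_prod_Suc zmod_zmult2_eq digit_def)
  finally show ?case .
qed

text \<open>Since \<open>y\<close> is below \<open>radix_prod b k\<close>, its digits beyond
  \<open>k\<close> vanish, and with them the second sum of \<open>flip\<close>.\<close>

lemma flip_eq_digit_rev:
  assumes "\<And>m. 1 \<le> m \<Longrightarrow> m < r \<Longrightarrow> 0 < b m" and "k < r" "0 \<le> y" "y < radix_prod b k"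
  shows "flip r y k b = digit_rev b k y"
proof -
  have "digit b m y = 0" if "m \<in> {k+1..r-1}" for m
  proof -
    have "radix_prod b (m - 1) = radix_prod b k * (\<Prod>j=k+1..m-1. b j)"
      using that by (intro radix_prod_split) auto
    moreover have "0 < (\<Prod>j=k+1..m-1. b j)"
      using that assms(1) by (intro prod_pos) auto
    ultimately have "radix_prod b k \<le> radix_prod b (m - 1)"
      using assms(3,4) by (simp add: mult_le_cancel_left1)
    then show ?thesis using assms(3,4) by (simp add: digit_def)
  qed
  then have "(\<Sum>m=k+1..r-1. digit b m y * radix_prod b (m - 1)) = 0"
    by (intro sum.neutral) auto
  then show ?thesis by (simp add: flip_def digit_rev_def)
qed

section \<open>Undoing a reversal in the flipped base\<close>

lemma prod_bflip:
  assumes "1 \<le> m" "m \<le> k + 1"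
  shows "(\<Prod>j=m..k. bflip b k j) = radix_prod b (k + 1 - m)"
  unfolding radix_prod_def
  by (rule prod.reindex_bij_witness[of _ "\<lambda>j. k + 1 - j" "\<lambda>j. k + 1 - j"])
     (use assms in \<open>auto simp: bflip_def\<close>)

text \<open>Together with its mirror image above, this exchanges the place values in one base with
  the weights of \<open>digit_rev\<close> in the other.\<close>

lemma radix_prod_bflip:
  assumes "m \<le> k"
  shows "radix_prod (bflip b k) m = (\<Prod>j=k+1-m..k. b j)"
  unfolding radix_prod_def
  by (rule prod.reindex_bij_witness[of _ "\<lambda>j. k + 1 - j" "\<lambda>j. k + 1 - j"])
     (use assms in \<open>auto simp: bflip_def\<close>)

text \<open>The digits of \<open>z\<close> in the flipped base, read backwards, are admissible
  digits for \<open>b\<close>, and \<open>?v\<close> is the number they spell. By uniqueness they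
  are its digits, so a second reversal restores the expansion of \<open>z\<close>.\<close>

lemma digit_rev_bflip:
  assumes "\<And>m. 1 \<le> m \<Longrightarrow> m \<le> k \<Longrightarrow> 0 < b m" and "0 \<le> z" "z < radix_prod b k"
  shows "digit_rev b k (digit_rev (bflip b k) k z) = z"
proof -
  let ?c = "bflip b k" and ?v = "digit_rev (bflip b k) k z"
  let ?d = "\<lambda>m. digit (bflip b k) (k + 1 - m) z"
  have pos: "0 < ?c m" if "1 \<le> m" "m \<le> k" for m
    using that assms(1) by (simp add: bflip_def)
  have d: "0 \<le> ?d m \<and> ?d m < b m" if "1 \<le> m" "m \<le> k" for m
  proof -
    have "?c (k + 1 - m) = b m" using that by (auto simp: bflip_def)
    then show ?thesis using digit_bounds[of ?c "k + 1 - m" z] pos[of "k + 1 - m"] that by simp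
  qed
  have "?v = (\<Sum>m=1..k. digit ?c m z * radix_prod b (k - m))"
    unfolding digit_rev_def by (rule sum.cong) (auto simp: prod_bflip)
  also have "\<dots> = (\<Sum>m=1..k. ?d m * radix_prod b (m - 1))"
    by (rule sum.reindex_bij_witness[of _ "\<lambda>j. k + 1 - j" "\<lambda>j. k + 1 - j"]) auto
  finally have v: "?v = (\<Sum>m=1..k. ?d m * radix_prod b (m - 1))" .
  have "digit_rev b k ?v = (\<Sum>m=1..k. ?d m * (\<Prod>j=m+1..k. b j))"
    unfolding digit_rev_def[of b]
    by (rule sum.cong) (use digit_unique[OF d v] in auto)
  \<comment> \<open>The lower limit \<open>k + 1 - (m - 1)\<close> is shaped for
    \<open>radix_prod_bflip\<close> at \<open>m - 1\<close>; for \<open>m = 1\<close> the product is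
    empty.\<close>
  also have "\<dots> = (\<Sum>m=1..k. digit ?c m z * (\<Prod>j=k+1-(m-1)..k. b j))"
    by (rule sum.reindex_bij_witness[of _ "\<lambda>j. k + 1 - j" "\<lambda>j. k + 1 - j"]) auto
  also have "\<dots> = (\<Sum>m=1..k. digit ?c m z * radix_prod ?c (m - 1))"
    by (rule sum.cong) (auto simp: radix_prod_bflip)
  also have "\<dots> = z"
    using digit_expansion[of k ?c z] pos assms(2,3) radix_prod_bflip[of k k b]
    by (simp add: radix_prod_def)
  finally show ?thesis .
qed

text \<open>Flipping the base keeps the product of its first \<open>k\<close> entries, so one bound
  serves both bases and both flips reduce to \<open>digit_rev\<close>. This is what turns the
  constructed schedule back into the given packing.\<close>

lemma flip_bflip:
  assumes "\<And>m. 1 \<le> m \<Longrightarrow> m < r \<Longrightarrow> 0 < b m" and "k < r" "0 \<le> z" "z < radix_prod b k"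
  defines "v \<equiv> flip r z k (bflip b k)"
  shows "0 \<le> v" and "v < radix_prod b k" and "flip r v k b = z"
proof -
  have pos: "0 < bflip b k m" if "1 \<le> m" "m < r" for m
    using that assms(1,2) by (simp add: bflip_def)
  have eq: "radix_prod (bflip b k) k = radix_prod b k"
    using radix_prod_bflip[of k k b] by (simp add: radix_prod_def)
  have v: "v = digit_rev (bflip b k) k z"
    unfolding v_def using pos assms eq by (intro flip_eq_digit_rev) auto
  show bds: "0 \<le> v" "v < radix_prod b k"
    using digit_rev_bounds[of k "bflip b k" z] pos assms(2) eq v by auto
  have "flip r v k b = digit_rev b k v"
    using assms(1,2) bds by (intro flip_eq_digit_rev) auto
  also have "\<dots> = z"
    unfolding v using assms by (intro digit_rev_bflip) auto
  finally show "flip r v k b = z" .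
qed

section \<open>Vertical overlap as a congruence\<close>

lemma div_eq_iff:
  fixes c q z :: int
  assumes "0 < c"
  shows "z div c = q \<longleftrightarrow> q * c \<le> z \<and> z < q * c + c"
proof
  assume "z div c = q"
  moreover have "z = z div c * c + z mod c" by simp
  moreover have "0 \<le> z mod c" "z mod c < c" using assms by simp_all
  ultimately show "q * c \<le> z \<and> z < q * c + c" by auto
next
  assume "q * c \<le> z \<and> z < q * c + c"
  then show "z div c = q"
    using assms by (intro int_div_pos_eq[of _ _ _ "z - q * c"]) (auto simp: mult.commute)
qed

text \<open>The left-hand side is the vertical part of the overlap condition.\<close>

lemma stacked_overlap_iff:
  assumes pos: "\<And>m. 1 \<le> m \<Longrightarrow> m \<le> l \<Longrightarrow> 0 < b m" and "k \<le> l" "0 < h"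
    and y: "0 \<le> y" "y < radix_prod b k"
  defines "c \<equiv> (\<Prod>j=k+1..l. b j)"
  shows "c * h * digit_rev b k y - h < h * digit_rev b l z \<and>
         h * digit_rev b l z < c * h * digit_rev b k y + c * h \<longleftrightarrow> z mod radix_prod b k = y"
    (is "?L < ?M \<and> ?M < ?R \<longleftrightarrow> _")
proof -
  let ?q = "digit_rev b k y" and ?z = "digit_rev b l z"
  have c: "0 < c" unfolding c_def using pos by (intro prod_pos) auto
  \<comment> \<open>Here \<open>h\<close> and \<open>c * h\<close> stand for the heights of
    rectangles \<open>j\<close> and \<open>i\<close>. Over the integers, being less than
    \<open>?z + 1\<close> means at most \<open>?z\<close>, so after division by \<open>h\<close> the
    bounds place \<open>?z\<close> in block \<open>?q\<close> of length \<open>c\<close>.\<close>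
  have "?L < ?M \<and> ?M < ?R \<longleftrightarrow> h * (?q * c) < h * (?z + 1) \<and> h * ?z < h * (?q * c + c)"
    by (simp add: algebra_simps)
  also have "\<dots> \<longleftrightarrow> ?q * c \<le> ?z \<and> ?z < ?q * c + c"
    using \<open>0 < h\<close> by auto
  also have "\<dots> \<longleftrightarrow> ?z div c = ?q"
    using div_eq_iff[OF c] by simp
  also have "\<dots> \<longleftrightarrow> digit_rev b k z = digit_rev b k y"
    unfolding c_def using digit_rev_div[of l b k z] pos \<open>k \<le> l\<close> by simp
  also have "\<dots> \<longleftrightarrow> z mod radix_prod b k = y"
    using digit_rev_eq_iff[of k b z y] pos \<open>k \<le> l\<close> y by simp
  finally show ?thesis .
qed

section \<open>Collisions in time\<close>

lemma occurrence_inter_iff: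
  "0 < p \<Longrightarrow> 0 < q \<Longrightarrow> occurrence S p s k \<inter> occurrence T q t l \<noteq> {} \<longleftrightarrow>
     s + int k * S < t + int l * T + q \<and> t + int l * T < s + int k * S + p"
  unfolding occurrence_def Int_atLeastLessThan atLeastLessThan_empty_iff not_not
    max_less_iff_conj min_less_iff_conj of_int_less_iff
  \<comment> \<open>Positive lengths settle two of the four inequalities, those between the two ends
    of one interval.\<close>
  by auto

text \<open>Neither interval leaves its slot of length \<open>w\<close>. Different slot numbers
  therefore keep the intervals apart, and equal ones cancel.\<close>

lemma slot_meet_iff:
  fixes w :: int
  assumes "0 < p" "0 < q" "0 \<le> u" "u + p \<le> w" "0 \<le> t" "t + q \<le> w"
  shows "u + a * w < t + c * w + q \<and> t + c * w < u + a * w + p \<longleftrightarrow>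
         a = c \<and> u < t + q \<and> t < u + p"
proof -
  have lt: "a * w + w \<le> c * w" if "a < c"
    using mult_right_mono[of "a + 1" c w] that assms by (simp add: distrib_right)
  have gt: "c * w + w \<le> a * w" if "c < a"
    using mult_right_mono[of "c + 1" a w] that assms by (simp add: distrib_right)
  consider "a < c" | "a = c" | "c < a" by linarith
  then show ?thesis
  proof cases
    case 1
    then show ?thesis using lt[OF 1] assms by linarith
  next
    case 2
    then show ?thesis by auto
  next
    case 3
    then show ?thesis using gt[OF 3] assms by linarith
  qed
qed

text \<open>As \<open>B\<close> divides \<open>C\<close>, every term of the second progression is
  congruent to \<open>v'\<close> modulo \<open>B\<close>.\<close>

lemma common_slot_iff:
  fixes B C :: int
  assumes "0 \<le> v" "v < B" "0 \<le> v'" "v' < C" "B dvd C"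
  shows "(\<exists>k l. v + int k * B = v' + int l * C) \<longleftrightarrow> v' mod B = v"
proof
  assume "\<exists>k l. v + int k * B = v' + int l * C"
  then obtain k l where eq: "v + int k * B = v' + int l * C" by blast
  obtain e where e: "C = B * e" using assms by blast
  have "(v + int k * B) mod B = (v' + int l * C) mod B" using eq by simp
  then show "v' mod B = v"
    using assms e by (simp add: mult.left_commute)
next
  assume "v' mod B = v"
  \<comment> \<open>The slot \<open>v'\<close> itself is common: it is term \<open>v' div B\<close>
    of the first progression, and this index is non-negative because \<open>v'\<close> is.\<close>
  then have "v + int (nat (v' div B)) * B = v' + int 0 * C"
    using assms by (auto simp: pos_imp_zdiv_nonneg_iff)
  then show "\<exists>k l. v + int k * B = v' + int l * C" by blast
qed

text \<open>For the converse, where the given \<open>y i\<close> are known to equal the values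
  computed from the schedule only at actual rectangles.\<close>

lemma feasible_packing_cong:
  assumes "\<And>i. i \<in> {1..num_rects P} \<Longrightarrow> y i = y' i"
  shows "feasible_packing P x y \<longleftrightarrow> feasible_packing P x y'"
  using assms by (simp add: feasible_packing_def overlap_def)

section \<open>Equivalence of schedules and packings\<close>

locale periodic_instance =
  fixes r n :: nat and T b p :: "nat \<Rightarrow> int" and \<pi> :: "nat \<Rightarrow> nat"
  assumes T_pos: "\<And>k. k < r \<Longrightarrow> 0 < T k"
    and base_pos: "\<And>k. 1 \<le> k \<Longrightarrow> k < r \<Longrightarrow> 0 < b k"
    and T_rec: "\<forall>k\<in>{1..<r}. T k = b k * T (k - 1)"
    and job: "\<And>i. i \<in> {1..n} \<Longrightarrow> 0 < p i \<and> \<pi> i < r"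
begin

abbreviation "h i \<equiv> T (r - 1) div T (\<pi> i)"

abbreviation "in_range u v \<equiv>
  \<forall>i\<in>{1..n}. 0 \<le> u i \<and> u i + p i \<le> T 0 \<and> 0 \<le> v i \<and> v i < radix_prod b (\<pi> i)"

text \<open>Written as a tail product of the base, a height shows its ratio to the height for a
  longer period: the product of the entries in between, which is the divisor in
  \<open>digit_rev_div\<close>.\<close>

lemma height_prod:
  assumes "k < r"
  shows "T (r - 1) div T k = (\<Prod>j=k+1..r-1. b j)"
  using height_eq[OF T_rec assms] radix_prod_split[of k "r - 1" b] T_pos[of 0] assms
    radix_prod_pos[of k b] base_pos by simp

lemma height_pos: "i \<in> {1..n} \<Longrightarrow> 0 < h i"
  using job height_prod base_pos by (auto intro!: prod_pos)

lemma height_times_prod: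
  assumes "i \<in> {1..n}"
  shows "h i * radix_prod b (\<pi> i) = radix_prod b (r - 1)"
proof -
  have "\<pi> i < r" using job[OF assms] by simp
  then have "\<pi> i \<le> r - 1" by simp
  then show ?thesis
    unfolding height_prod[OF \<open>\<pi> i < r\<close>] by (simp only: radix_prod_split mult.commute)
qed

lemma flip_range:
  assumes "i \<in> {1..n}" "0 \<le> v" "v < radix_prod b (\<pi> i)"
  shows "flip r v (\<pi> i) b = digit_rev b (\<pi> i) v"
    and "0 \<le> flip r v (\<pi> i) b" and "flip r v (\<pi> i) b < radix_prod b (\<pi> i)"
proof -
  show *: "flip r v (\<pi> i) b = digit_rev b (\<pi> i) v"
    using assms job base_pos by (intro flip_eq_digit_rev) auto
  show "0 \<le> flip r v (\<pi> i) b" "flip r v (\<pi> i) b < radix_prod b (\<pi> i)"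
    unfolding * using digit_rev_bounds[of "\<pi> i" b v] job[OF assms(1)] base_pos by simp_all
qed

lemma collision_iff_overlap_aux:
  assumes ij: "i \<in> {1..n}" "j \<in> {1..n}" and le: "\<pi> i \<le> \<pi> j" and range: "in_range u v"
  shows "(\<exists>k l. occurrence (T (\<pi> i)) (p i) (start_offset T u v i) k \<inter>
                occurrence (T (\<pi> j)) (p j) (start_offset T u v j) l \<noteq> {}) \<longleftrightarrow>
         overlap (to_packing r T b n p \<pi>) u (\<lambda>i. h i * flip r (v i) (\<pi> i) b) i j"
proof -
  have jobs: "0 < p i" "0 < p j" "\<pi> i < r" "\<pi> j < r"
    using job[OF ij(1)] job[OF ij(2)] by simp_all
  have T: "T (\<pi> i) = radix_prod b (\<pi> i) * T 0" "T (\<pi> j) = radix_prod b (\<pi> j) * T 0"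
    by (fact period_eq[OF T_rec jobs(3)] period_eq[OF T_rec jobs(4)])+
  have meet: "occurrence (T (\<pi> i)) (p i) (start_offset T u v i) k \<inter>
         occurrence (T (\<pi> j)) (p j) (start_offset T u v j) l \<noteq> {} \<longleftrightarrow>
       v i + int k * radix_prod b (\<pi> i) = v j + int l * radix_prod b (\<pi> j) \<and>
       u i < u j + p j \<and> u j < u i + p i" for k l
  proof -
    \<comment> \<open>Occurrence \<open>k\<close> of job \<open>i\<close> starts at position
      \<open>u i\<close> of slot \<open>v i + int k * radix_prod b (\<pi> i)\<close>. The condition
      on \<open>u\<close> is then free of \<open>k\<close> and \<open>l\<close>, and only the
      equality of slots stays under the quantifiers.\<close>
    have off: "start_offset T u v i + int k * T (\<pi> i) =
          u i + (v i + int k * radix_prod b (\<pi> i)) * T 0"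
        "start_offset T u v j + int l * T (\<pi> j) =
          u j + (v j + int l * radix_prod b (\<pi> j)) * T 0"
      unfolding T start_offset_def by (simp_all add: algebra_simps)
    show ?thesis
      unfolding occurrence_inter_iff[OF jobs(1,2)] off
      using range ij jobs by (intro slot_meet_iff) auto
  qed
  have "radix_prod b (\<pi> i) dvd radix_prod b (\<pi> j)"
    using radix_prod_split[OF le] by simp
  then have slot: "(\<exists>k l. v i + int k * radix_prod b (\<pi> i) = v j + int l * radix_prod b (\<pi> j)) \<longleftrightarrow>
      v j mod radix_prod b (\<pi> i) = v i"
    using range ij by (intro common_slot_iff) auto
  \<comment> \<open>The split exhibits \<open>h i\<close> as a multiple of \<open>h j\<close>; the
    factor is the \<open>c\<close> of \<open>stacked_overlap_iff\<close>.\<close>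
  have "{\<pi> i + 1..r - 1} = {\<pi> i + 1..\<pi> j} \<union> {\<pi> j + 1..r - 1}"
    using le jobs by auto
  then have hi: "h i = (\<Prod>m=\<pi> i+1..\<pi> j. b m) * h j"
    unfolding height_prod[OF jobs(3)] height_prod[OF jobs(4)]
    by (simp add: prod.union_disjoint)
  have vert: "h i * flip r (v i) (\<pi> i) b - h j < h j * flip r (v j) (\<pi> j) b \<and>
      h j * flip r (v j) (\<pi> j) b < h i * flip r (v i) (\<pi> i) b + h i \<longleftrightarrow>
      v j mod radix_prod b (\<pi> i) = v i"
  proof -
    have flips: "flip r (v i) (\<pi> i) b = digit_rev b (\<pi> i) (v i)"
        "flip r (v j) (\<pi> j) b = digit_rev b (\<pi> j) (v j)"
      using range ij by (auto intro!: flip_range(1))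
    show ?thesis
      unfolding hi flips
      by (rule stacked_overlap_iff)
        (use base_pos jobs le height_pos[OF ij(2)] range ij(1) in simp_all)
  qed
  have "(\<exists>k l. occurrence (T (\<pi> i)) (p i) (start_offset T u v i) k \<inter>
                occurrence (T (\<pi> j)) (p j) (start_offset T u v j) l \<noteq> {}) \<longleftrightarrow>
      v j mod radix_prod b (\<pi> i) = v i \<and> u i < u j + p j \<and> u j < u i + p i"
    unfolding meet using slot by auto
  also have "\<dots> \<longleftrightarrow> overlap (to_packing r T b n p \<pi>) u (\<lambda>i. h i * flip r (v i) (\<pi> i) b) i j"
    using vert by (auto simp: overlap_def to_packing_def)
  finally show ?thesis .
qed

text \<open>Collision and overlap are symmetric in \<open>i\<close> and \<open>j\<close>, with
  \<open>k\<close> and \<open>l\<close> trading places, so the case \<pi> i \<le> \<pi> j settles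
  the other.\<close>

lemma collision_iff_overlap:
  assumes ij: "i \<in> {1..n}" "j \<in> {1..n}" and range: "in_range u v"
  shows "(\<exists>k l. occurrence (T (\<pi> i)) (p i) (start_offset T u v i) k \<inter>
                occurrence (T (\<pi> j)) (p j) (start_offset T u v j) l \<noteq> {}) \<longleftrightarrow>
         overlap (to_packing r T b n p \<pi>) u (\<lambda>i. h i * flip r (v i) (\<pi> i) b) i j"
proof (cases "\<pi> i \<le> \<pi> j")
  case True
  then show ?thesis by (rule collision_iff_overlap_aux[OF ij _ range])
next
  case False
  have sym: "overlap P x y i j \<longleftrightarrow> overlap P x y j i" for P x y
    by (auto simp: overlap_def)
  show ?thesis
    using collision_iff_overlap_aux[OF ij(2,1) _ range] False
    by (subst sym, subst ex_comm, subst Int_commute) simp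
qed

text \<open>Offsets in range force every rectangle into the bin, which leaves only the pairwise
  conditions to compare.\<close>

lemma feasible_schedule_iff_packing:
  assumes range: "in_range u v"
  shows "feasible_schedule T b n p \<pi> u v \<longleftrightarrow>
    feasible_packing (to_packing r T b n p \<pi>) u (\<lambda>i. h i * flip r (v i) (\<pi> i) b)"
proof -
  have bin: "0 \<le> h i * flip r (v i) (\<pi> i) b \<and>
      h i * flip r (v i) (\<pi> i) b + h i \<le> radix_prod b (r - 1)" if i: "i \<in> {1..n}" for i
  proof -
    let ?f = "flip r (v i) (\<pi> i) b"
    have f: "0 \<le> ?f" "?f + 1 \<le> radix_prod b (\<pi> i)"
      using flip_range[OF i, of "v i"] range i by auto
    \<comment> \<open>The left side is the top edge of the rectangle, the right side the bin
      height.\<close>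
    have "h i * (?f + 1) \<le> h i * radix_prod b (\<pi> i)"
      using f height_pos[OF i] by (intro mult_left_mono) auto
    then show ?thesis
      using f height_pos[OF i] height_times_prod[OF i] by (simp add: distrib_left)
  qed
  let ?P = "to_packing r T b n p \<pi>" and ?y = "\<lambda>i. h i * flip r (v i) (\<pi> i) b"
  have "feasible_packing ?P u ?y \<longleftrightarrow>
      (\<forall>i\<in>{1..n}. \<forall>j\<in>{1..n}. i \<noteq> j \<longrightarrow> \<not> overlap ?P u ?y i j)"
    using bin range by (auto simp: feasible_packing_def to_packing_def)
  also have "\<dots> \<longleftrightarrow> (\<forall>i\<in>{1..n}. \<forall>j\<in>{1..n}. i \<noteq> j \<longrightarrow>
      (\<forall>k l. occurrence (T (\<pi> i)) (p i) (start_offset T u v i) k \<inter>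
             occurrence (T (\<pi> j)) (p j) (start_offset T u v j) l = {}))"
    by (intro ball_cong refl imp_cong, subst collision_iff_overlap[OF _ _ range, symmetric])
      simp_all
  also have "\<dots> \<longleftrightarrow> feasible_schedule T b n p \<pi> u v"
    unfolding feasible_schedule_def
    by (rule iffI, rule conjI[OF range], assumption, erule conjunct2)
  finally show ?thesis by simp
qed

lemma schedule_to_packing:
  assumes "feasible_schedule T b n p \<pi> u v"
  shows "feasible_packing (to_packing r T b n p \<pi>) u (\<lambda>i. h i * flip r (v i) (\<pi> i) b)"
  using assms feasible_schedule_iff_packing[of u v] by (auto simp: feasible_schedule_def)

text \<open>By \<open>flip_bflip\<close> the packing computed from \<open>?v\<close> is the given
  one, so the equivalence can be read from right to left.\<close>

lemma packing_to_schedule: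
  assumes feas: "feasible_packing (to_packing r T b n p \<pi>) x y"
    and dvd: "height_divisible (to_packing r T b n p \<pi>) y"
  shows "feasible_schedule T b n p \<pi> x (\<lambda>i. flip r (y i div h i) (\<pi> i) (bflip b (\<pi> i)))"
proof -
  let ?v = "\<lambda>i. flip r (y i div h i) (\<pi> i) (bflip b (\<pi> i))"
  have v: "0 \<le> ?v i" "?v i < radix_prod b (\<pi> i)" "y i = h i * flip r (?v i) (\<pi> i) b"
    if i: "i \<in> {1..n}" for i
  proof -
    have y: "0 \<le> y i" "y i + h i \<le> radix_prod b (r - 1)" "h i dvd y i"
      using feas dvd i by (auto simp: feasible_packing_def height_divisible_def to_packing_def)
    then obtain z where z: "y i = h i * z" by blast
    note pos = height_pos[OF i]
    \<comment> \<open>Strictness comes from the rectangle's own positive height: its top edge, too,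
      is inside the bin.\<close>
    have "h i * z < h i * radix_prod b (\<pi> i)"
      using y z pos height_times_prod[OF i] by simp
    then have z_range: "0 \<le> z" "z < radix_prod b (\<pi> i)"
      using y z pos by (auto simp: zero_le_mult_iff)
    have "y i div h i = z" using z pos by simp
    then show "0 \<le> ?v i" "?v i < radix_prod b (\<pi> i)" "y i = h i * flip r (?v i) (\<pi> i) b"
      using flip_bflip[OF base_pos _ z_range] job[OF i] z by simp_all
  qed
  have range: "in_range x ?v"
    using feas v by (auto simp: feasible_packing_def to_packing_def)
  have "num_rects (to_packing r T b n p \<pi>) = n"
    by (simp add: to_packing_def)
  then have "feasible_packing (to_packing r T b n p \<pi>) x y \<longleftrightarrow>
      feasible_packing (to_packing r T b n p \<pi>) x (\<lambda>i. h i * flip r (?v i) (\<pi> i) b)"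
    by (intro feasible_packing_cong v(3)) (simp only:)
  with feas have "feasible_packing (to_packing r T b n p \<pi>) x (\<lambda>i. h i * flip r (?v i) (\<pi> i) b)"
    by (rule iffD1[rotated])
  then show ?thesis
    unfolding feasible_schedule_iff_packing[OF range] .
qed

end

theorem theorem1:
  fixes r n :: nat and T b p :: "nat \<Rightarrow> int" and \<pi> :: "nat \<Rightarrow> nat"
  assumes "1 \<le> r"
    and "\<forall>k<r. 0 < T k"
    and "strict_mono_on {..<r} T"
    and "\<forall>k\<in>{1..<r}. 2 \<le> b k"
    and "\<forall>k\<in>{1..<r}. T k = b k * T (k - 1)"
    and "\<forall>i\<in>{1..n}. 0 < p i \<and> \<pi> i < r"
  shows "(\<forall>u v. feasible_schedule T b n p \<pi> u v \<longrightarrow>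
            (let P = to_packing r T b n p \<pi>;
                 x = u;
                 y = (\<lambda>i. rect_height P i * flip r (v i) (\<pi> i) b)
             in feasible_packing P x y \<and> height_divisible P y)) \<and>
         (\<forall>x y. (let P = to_packing r T b n p \<pi>;
                     u = x;
                     v = (\<lambda>i. flip r (y i div rect_height P i) (\<pi> i) (bflip b (\<pi> i)))
                 in feasible_packing P x y \<and> height_divisible P y \<longrightarrow>
                    feasible_schedule T b n p \<pi> u v))"
proof -
  interpret periodic_instance r n T b p \<pi>
  proof
    show "0 < b k" if "1 \<le> k" "k < r" for k
      using assms(4) that by force
  qed (use assms in auto)
  have "rect_height (to_packing r T b n p \<pi>) = (\<lambda>i. T (r - 1) div T (\<pi> i))"
    by (simp add: to_packing_def)
  then show ?thesis
    using schedule_to_packing packing_to_schedule by (simp add: Let_def height_divisible_def)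
qed

end
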